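(* Let $n,r$ be non-negative integers, $p$ a prime number and $m\in\{0,1,\dots,p-1\}$. Then $$\sum_{k=m}^{p-1}(-x)^k\frac{\mathcal{F}_n(x;r+k,k)}{(k-m)!}\equiv (-1)^m m!\,(r+m)^n\,\mathcal{P}_{p-1}(x;m)\pmod{p\mathbb{Z}_p[x]}.$$ In particular, for $m=0$, $$\sum_{k=0}^{p-1}(-x)^k\frac{\mathcal{F}_n(x;r+k,k)}{k!}\equiv r^n\sum_{i=0}^{p-1}(-x)^i\pmod{p\mathbb{Z}_p[x]}.$$
   Context: ${n\brace k}_r$ denotes the $r$-Stirling numbers of the second kind: the number of partitions of $\{1,\dots,n\}$ into $k$ nonempty blocks such that $1,\dots,r$ lie in distinct blocks. The $(r,s)$-Fubini polynomials are $\mathcal{F}_n(x;r,s)=\sum_{k=0}^n {n+r\brace k+r}_r (k+s)!\,x^k$. The polynomials $\mathcal{P}_n$ are $\mathcal{P}_n(x;r)=\sum_{j=0}^n(-1)^j\binom{j+r}{r}x^{n-j}$. Convention $0^0=1$. $\mathbb{Z}_p$ is the ring of $p$-adic integers, and $A\equiv B\pmod{p\mathbb{Z}_p[x]}$ means corresponding coefficients are congruent modulo $p$ (the factorials in denominators are invertible mod $p$ since $k<p$). *)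

theory Defs
  imports
    "HOL-Library.Disjoint_Sets"
    "HOL-Computational_Algebra.Computational_Algebra"
    "HOL-Number_Theory.Cong"
    "HOL-Algebra.Ideal"
begin

section \<open>Combinatorial polynomials\<close>

definition r_Stirling2 :: "nat \<Rightarrow> nat \<Rightarrow> nat \<Rightarrow> nat" where
  "r_Stirling2 r n k =
     card {P. partition_on {1..n} P \<and> card P = k \<and>
              (\<exists>b. inj_on b {1..r} \<and> (\<forall>i\<in>{1..r}. b i \<in> P \<and> i \<in> b i))}"

definition Fubini_poly :: "nat \<Rightarrow> nat \<Rightarrow> nat \<Rightarrow> rat poly" where
  "Fubini_poly n r s =
     (\<Sum>k=0..n. monom (of_nat (r_Stirling2 r (n + r) (k + r)) * fact (k + s)) k)"

definition P_poly :: "nat \<Rightarrow> nat \<Rightarrow> rat poly" where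
  "P_poly n r = (\<Sum>j=0..n. monom ((-1) ^ j * of_nat ((j + r) choose r)) (n - j))"


section \<open>The ring of $p$-adic integers\<close>

text \<open>
  The inverse limit of the rings $\mathbb{Z}/p^k\mathbb{Z}$: an element is a compatible sequence
  of least non-negative residues, the entry at index \<open>k\<close> being the residue modulo $p^k$.
\<close>

definition padic_ints :: "nat \<Rightarrow> (nat \<Rightarrow> int) ring" where
  "padic_ints p =
     \<lparr> carrier = {z. \<forall>k. z k \<in> {0..<int p ^ k} \<and> z (Suc k) mod int p ^ k = z k},
       mult = (\<lambda>y z k. (y k * z k) mod int p ^ k),
       one = (\<lambda>k. 1 mod int p ^ k),
       zero = (\<lambda>k. 0),
       add = (\<lambda>y z k. (y k + z k) mod int p ^ k) \<rparr>"

definition padic_of_int :: "nat \<Rightarrow> int \<Rightarrow> nat \<Rightarrow> int" where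
  "padic_of_int p a = (\<lambda>k. a mod int p ^ k)"

text \<open>
  The rational number $q = a/b$, viewed in $\mathbb{Q}_p$, is equal to the $p$-adic integer \<open>z\<close>,
  that is, $b z = a$ in $\mathbb{Z}_p$.
\<close>

definition padic_eq_rat :: "nat \<Rightarrow> (nat \<Rightarrow> int) \<Rightarrow> rat \<Rightarrow> bool" where
  "padic_eq_rat p z q \<longleftrightarrow>
     z \<in> carrier (padic_ints p) \<and>
     padic_of_int p (snd (quotient_of q)) \<otimes>\<^bsub>padic_ints p\<^esub> z = padic_of_int p (fst (quotient_of q))"

text \<open>
  Congruence modulo $p\mathbb{Z}_p[x]$ of two polynomials with rational coefficients: all
  coefficients are $p$-adic integers, and corresponding ones differ by an element of the ideal
  $p\mathbb{Z}_p$.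
\<close>

definition padic_poly_cong :: "nat \<Rightarrow> rat poly \<Rightarrow> rat poly \<Rightarrow> bool" where
  "padic_poly_cong p A B \<longleftrightarrow>
     (\<forall>i. \<exists>u v. padic_eq_rat p u (coeff A i) \<and> padic_eq_rat p v (coeff B i) \<and>
        u \<ominus>\<^bsub>padic_ints p\<^esub> v \<in> PIdl\<^bsub>padic_ints p\<^esub> (padic_of_int p (int p)))"


subsection \<open>Basic facts\<close>

lemma padic_of_int_closed: "p > 0 \<Longrightarrow> padic_of_int p a \<in> carrier (padic_ints p)"
  by (auto simp: padic_of_int_def padic_ints_def mod_mod_cancel)

lemma padic_ints_mod_cancel:
  "(x::int) mod int p ^ Suc k mod int p ^ k = x mod int p ^ k"
  by (rule mod_mod_cancel) simp

lemma cring_padic_ints: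
  assumes p: "p > 0"
  shows "cring (padic_ints p)"
proof (rule cringI)
  show "abelian_group (padic_ints p)"
  proof (rule abelian_groupI)
    fix x y assume "x \<in> carrier (padic_ints p)" "y \<in> carrier (padic_ints p)"
    then show "x \<oplus>\<^bsub>padic_ints p\<^esub> y \<in> carrier (padic_ints p)"
      using p by (auto simp: padic_ints_def padic_ints_mod_cancel simp del: power_Suc)
        (metis mod_add_eq)
  next
    fix x assume x: "x \<in> carrier (padic_ints p)"
    show "\<exists>y\<in>carrier (padic_ints p). y \<oplus>\<^bsub>padic_ints p\<^esub> x = \<zero>\<^bsub>padic_ints p\<^esub>"
      using x p
      by (intro bexI[of _ "\<lambda>k. (- x k) mod int p ^ k"])
        (auto simp: padic_ints_def padic_ints_mod_cancel mod_simps simp del: power_Suc,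
          metis mod_minus_eq)
  qed (use p in \<open>auto simp: padic_ints_def mod_simps ac_simps fun_eq_iff\<close>)
  show "Group.comm_monoid (padic_ints p)"
  proof (rule comm_monoidI)
    fix x y assume "x \<in> carrier (padic_ints p)" "y \<in> carrier (padic_ints p)"
    then show "x \<otimes>\<^bsub>padic_ints p\<^esub> y \<in> carrier (padic_ints p)"
      using p by (auto simp: padic_ints_def padic_ints_mod_cancel simp del: power_Suc)
        (metis mod_mult_eq)
  next
    show "\<one>\<^bsub>padic_ints p\<^esub> \<in> carrier (padic_ints p)"
      using padic_of_int_closed[OF p, of 1] by (simp add: padic_ints_def padic_of_int_def)
  qed (use p in \<open>auto simp: padic_ints_def mod_simps ac_simps fun_eq_iff\<close>)
qed (use p in \<open>auto simp: padic_ints_def mod_simps algebra_simps fun_eq_iff\<close>)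

lemma padic_eq_rat_of_int_iff:
  assumes "p > 0"
  shows "padic_eq_rat p z (of_int a) \<longleftrightarrow> z = padic_of_int p a"
  using padic_of_int_closed[OF assms, of a]
  by (auto simp: padic_eq_rat_def padic_of_int_def padic_ints_def mod_simps fun_eq_iff)

lemma padic_of_int_diff:
  assumes p: "p > 0"
  shows "padic_of_int p a \<ominus>\<^bsub>padic_ints p\<^esub> padic_of_int p b = padic_of_int p (a - b)"
proof -
  interpret cring "padic_ints p" by (rule cring_padic_ints[OF p])
  have add: "padic_of_int p c \<oplus>\<^bsub>padic_ints p\<^esub> padic_of_int p d = padic_of_int p (c + d)" for c d
    by (simp add: padic_of_int_def padic_ints_def mod_simps)
  have "\<ominus>\<^bsub>padic_ints p\<^esub> padic_of_int p b = padic_of_int p (- b)"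
    by (rule minus_equality)
      (auto simp: add padic_of_int_closed[OF p], simp add: padic_of_int_def padic_ints_def)
  then show ?thesis
    by (simp add: a_minus_def add)
qed

lemma padic_of_int_in_PIdl_iff:
  assumes p: "p > 0"
  shows "padic_of_int p a \<in> PIdl\<^bsub>padic_ints p\<^esub> (padic_of_int p (int p)) \<longleftrightarrow> int p dvd a"
proof
  assume "padic_of_int p a \<in> PIdl\<^bsub>padic_ints p\<^esub> (padic_of_int p (int p))"
  then obtain z where "padic_of_int p a = z \<otimes>\<^bsub>padic_ints p\<^esub> padic_of_int p (int p)"
    by (auto simp: cgenideal_def)
  from fun_cong[OF this, of 1] show "int p dvd a"
    by (auto simp: padic_of_int_def padic_ints_def)
next
  assume "int p dvd a"
  then obtain c where "a = int p * c" by blast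
  then have "padic_of_int p a = padic_of_int p c \<otimes>\<^bsub>padic_ints p\<^esub> padic_of_int p (int p)"
    by (simp add: padic_of_int_def padic_ints_def mod_simps ac_simps)
  then show "padic_of_int p a \<in> PIdl\<^bsub>padic_ints p\<^esub> (padic_of_int p (int p))"
    using padic_of_int_closed[OF p] by (auto simp: cgenideal_def)
qed

lemma padic_poly_cong_of_int_iff:
  assumes p: "p > 0"
    and A: "\<And>i. coeff A i = of_int (a i)" and B: "\<And>i. coeff B i = of_int (b i)"
  shows "padic_poly_cong p A B \<longleftrightarrow> (\<forall>i. [a i = b i] (mod int p))"
  by (simp add: padic_poly_cong_def A B padic_eq_rat_of_int_iff[OF p] padic_of_int_diff[OF p]
      padic_of_int_in_PIdl_iff[OF p] cong_iff_dvd_diff)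

lemma padic_rat_iff:
  assumes p: "prime p"
  shows "(\<exists>z. padic_eq_rat p z q) \<longleftrightarrow> \<not> int p dvd snd (quotient_of q)"
proof -
  obtain a b where q: "quotient_of q = (a, b)" by fastforce
  have p0: "p > 0" using p prime_gt_0_nat by blast
  have cop: "coprime a b" using q by (rule quotient_of_coprime)
  show ?thesis
  proof
    assume "\<exists>z. padic_eq_rat p z q"
    then obtain z where "padic_of_int p b \<otimes>\<^bsub>padic_ints p\<^esub> z = padic_of_int p a"
      by (auto simp: padic_eq_rat_def q)
    from fun_cong[OF this, of 1] have eq: "b * z 1 mod int p = a mod int p"
      by (simp add: padic_of_int_def padic_ints_def mod_simps)
    show "\<not> int p dvd snd (quotient_of q)"
    proof
      assume "int p dvd snd (quotient_of q)"
      then have b: "int p dvd b" by (simp add: q)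
      with eq have "int p dvd a" by (metis dvd_mult2 mod_eq_0_iff_dvd)
      with b cop have "is_unit (int p)" by (meson coprime_common_divisor)
      with p show False by (simp add: prime_nat_iff)
    qed
  next
    assume "\<not> int p dvd snd (quotient_of q)"
    then have "coprime (int p) b"
      using p by (intro prime_imp_coprime) (auto simp: q)
    then have cop_b: "coprime b (int p ^ k)" for k
      by (simp add: coprime_commute)
    then have "\<exists>c. [b * c = 1] (mod int p ^ k)" for k
      by (rule cong_solve_coprime_int)
    then obtain c where c: "\<And>k. [b * c k = 1] (mod int p ^ k)" by metis
    define z where "z = (\<lambda>k. a * c k mod int p ^ k)"
    have z: "b * z k mod int p ^ k = a mod int p ^ k" for k
      using cong_scalar_left[OF c[of k], of a]
      by (simp add: z_def cong_def mod_simps ac_simps)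
    have "z (Suc k) mod int p ^ k = z k" for k
    proof -
      have "[b * z (Suc k) = a] (mod int p ^ k)"
        using z[of "Suc k"] by (metis cong_def padic_ints_mod_cancel)
      then have "[b * z (Suc k) = b * z k] (mod int p ^ k)"
        using z[of k] by (simp add: cong_def)
      then have "[z (Suc k) = z k] (mod int p ^ k)"
        using cop_b cong_mult_lcancel by blast
      then show ?thesis by (simp add: cong_def z_def)
    qed
    moreover have "z k \<in> {0..<int p ^ k}" for k
      using p0 by (simp add: z_def)
    ultimately have "padic_eq_rat p z q"
      using z by (auto simp: padic_eq_rat_def q padic_ints_def padic_of_int_def mod_simps)
    then show "\<exists>z. padic_eq_rat p z q" by blast
  qed
qed

end

theory Submission
  imports Defs
begin

text \<open>
  The coefficient of \<open>x ^ t\<close> on the left is the sum over \<open>k\<close> of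
  \<open>(-1) ^ k * t! / (k - m)!\<close> times the \<open>(r + k)\<close>-Stirling number of \<open>n + r + k\<close> and \<open>r + t\<close>,
  where \<open>m \<le> k \<le> min (p - 1) t\<close>. For \<open>t \<ge> p\<close> every \<open>t! / (k - m)!\<close> is divisible by \<open>p\<close>.
  For \<open>t < p\<close> the recurrence of the Stirling numbers in their first argument shows, by induction
  on \<open>n\<close>, that the sum is exactly \<open>(-1) ^ t * m! * (t choose m) * (r + m) ^ n\<close>. The right-hand side
  agrees modulo \<open>p\<close> because \<open>m! * (p - 1 - t + m choose m)\<close> is the product of the \<open>m\<close> numbers
  \<open>p - 1 - t + i\<close>, which are congruent to \<open>- (t + 1 - i)\<close>.
\<close>

section \<open>Partitions whose blocks separate a given set\<close>

text \<open>A condition on blocks replaces the injective choice of blocks, and the sets are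
  arbitrary, so that elements outside \<open>B\<close> can be added to \<open>A\<close> one at a
  time.\<close>

definition separating_partitions :: "'a set \<Rightarrow> 'a set \<Rightarrow> 'a set set set" where
  "separating_partitions B A =
     {P. partition_on A P \<and> (\<forall>X\<in>P. \<forall>i\<in>X \<inter> B. \<forall>j\<in>X \<inter> B. i = j)}"

lemma finite_separating_partitions: "finite A \<Longrightarrow> finite (separating_partitions B A)"
  by (rule finite_subset[OF _ finitely_many_partition_on[of A]])
     (auto simp: separating_partitions_def)

text \<open>The choice \<open>b\<close> is forced: since \<open>r \<le> n\<close>, each
  \<open>i\<close> up to \<open>r\<close> lies in exactly one block, and injectivity says that no
  block contains two such elements.\<close>

lemma r_Stirling2_eq_card:
  assumes "r \<le> n"
  shows "r_Stirling2 r n k = card {P \<in> separating_partitions {1..r} {1..n}. card P = k}"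
proof -
  have *: "(\<exists>b. inj_on b {1..r} \<and> (\<forall>i\<in>{1..r}. b i \<in> P \<and> i \<in> b i)) \<longleftrightarrow>
        (\<forall>X\<in>P. \<forall>i\<in>X \<inter> {1..r}. \<forall>j\<in>X \<inter> {1..r}. i = j)" (is "?L \<longleftrightarrow> ?R")
    if P: "partition_on {1..n} P" for P
  proof
    assume ?L
    then obtain b where b: "inj_on b {1..r}" "\<And>i. i \<in> {1..r} \<Longrightarrow> b i \<in> P \<and> i \<in> b i"
      by blast
    have "X = b i" if "X \<in> P" "i \<in> X" "i \<in> {1..r}" for X i
      using that b(2)[of i] partition_onD2[OF P] by (auto simp: disjoint_def)
    then show ?R
      using b(1) unfolding inj_on_def by blast
  next
    assume R: ?R
    have "\<exists>X\<in>P. i \<in> X" if "i \<in> {1..r}" for i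
    proof -
      have "i \<in> {1..n}" using that assms by auto
      then show ?thesis using partition_onD1[OF P] by blast
    qed
    then obtain b where b: "\<And>i. i \<in> {1..r} \<Longrightarrow> b i \<in> P \<and> i \<in> b i"
      by metis
    have "inj_on b {1..r}"
    proof (rule inj_onI)
      fix i j assume ij: "i \<in> {1..r}" "j \<in> {1..r}" "b i = b j"
      then have "i \<in> b i \<inter> {1..r}" "j \<in> b i \<inter> {1..r}" "b i \<in> P"
        using b by auto
      then show "i = j" using R by blast
    qed
    then show ?L using b by blast
  qed
  have conj_assoc_cong: "(Q1 \<and> Q2 \<and> Q3) = ((Q1 \<and> Q4) \<and> Q2)" if "Q1 \<Longrightarrow> Q3 = Q4" for Q1 Q2 Q3 Q4
    using that by blast
  show ?thesis
    unfolding r_Stirling2_def separating_partitions_def mem_Collect_eq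
    by (rule arg_cong[where f = card], rule Collect_cong, rule conj_assoc_cong, rule *)
qed

lemma separating_partitions_self:
  "separating_partitions B B = {(\<lambda>i. {i}) ` B}"
proof (intro equalityI subsetI)
  fix P assume "P \<in> separating_partitions B B"
  then have P: "partition_on B P"
    and eq: "\<And>X i j. X \<in> P \<Longrightarrow> i \<in> X \<Longrightarrow> i \<in> B \<Longrightarrow> j \<in> X \<Longrightarrow> j \<in> B \<Longrightarrow> i = j"
    by (auto simp: separating_partitions_def)
  have block: "X = {i}" if "X \<in> P" "i \<in> X" for X i
    using that eq[OF that(1)] partition_onD1[OF P] by blast
  have "P = (\<lambda>i. {i}) ` B"
  proof (intro equalityI subsetI)
    fix X assume X: "X \<in> P"
    then obtain i where "i \<in> X"
      using partition_onD3[OF P] by (metis equals0I)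
    then show "X \<in> (\<lambda>i. {i}) ` B"
      using block[OF X] X partition_onD1[OF P] by blast
  next
    fix X assume "X \<in> (\<lambda>i. {i}) ` B"
    then obtain i where i: "i \<in> B" "X = {i}" by blast
    then obtain Y where "Y \<in> P" "i \<in> Y"
      using partition_onD1[OF P] by blast
    then show "X \<in> P" using block i by metis
  qed
  then show "P \<in> {(\<lambda>i. {i}) ` B}" by simp
next
  fix P assume "P \<in> {(\<lambda>i. {i}) ` B}"
  then show "P \<in> separating_partitions B B"
    by (auto simp: separating_partitions_def partition_on_def disjoint_def)
qed

text \<open>
  A partition of \<open>insert a A\<close> amounts to a partition of \<open>A\<close> together with the block which \<open>a\<close>
  joins, the empty set standing for a new block.
\<close>

lemma bij_betw_separating_partitions_insert:
  assumes a: "a \<notin> A" "a \<notin> B"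
  shows "bij_betw (\<lambda>(P, X). insert (insert a X) (P - {X}))
           (SIGMA P:separating_partitions B A. insert {} P) (separating_partitions B (insert a A))"
    (is "bij_betw ?f ?S ?T")
\<comment> \<open>The inverse deletes \<open>a\<close> from every block and remembers what is left
  of its block. If that block was \<open>{a}\<close>, the remainder is \<open>{}\<close>, which must
  be dropped from the partition but kept as the second component.\<close>
proof (rule bij_betw_byWitness[where f' =
      "\<lambda>Q. ((\<lambda>Y. Y - {a}) ` Q - {{}}, \<Union>{Y \<in> Q. a \<in> Y} - {a})"])
  let ?g = "\<lambda>Q. ((\<lambda>Y. Y - {a}) ` Q - {{}}, \<Union>{Y \<in> Q. a \<in> Y} - {a})"
  show "\<forall>z\<in>?S. ?g (?f z) = z"
  proof
    fix z assume "z \<in> ?S"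
    then obtain P X where z: "z = (P, X)" and P: "partition_on A P" and X: "X \<in> insert {} P"
      by (auto simp: separating_partitions_def)
    have na: "a \<notin> Y" if "Y \<in> P" for Y
      using that partition_onD1[OF P] a by blast
    have na': "a \<notin> X" using X na by auto
    have ne: "{} \<notin> P" using partition_onD3[OF P] .
    have "(\<lambda>Y. Y - {a}) ` (P - {X}) = (\<lambda>Y. Y) ` (P - {X})"
      by (rule image_cong) (use na in auto)
    then have "(\<lambda>Y. Y - {a}) ` insert (insert a X) (P - {X}) - {{}} = P"
      using na' ne X by auto
    moreover have "{Y \<in> insert (insert a X) (P - {X}). a \<in> Y} = {insert a X}"
      using na by auto
    ultimately show "?g (?f z) = z"
      using na' by (simp add: z)
  qed
  show "\<forall>Q\<in>?T. ?f (?g Q) = Q" and "?g ` ?T \<subseteq> ?S"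
  proof -
    have *: "?f (?g Q) = Q \<and> ?g Q \<in> ?S" if Q: "Q \<in> ?T" for Q
    proof -
      have part: "partition_on (insert a A) Q"
        and sep: "\<And>X i j. X \<in> Q \<Longrightarrow> i \<in> X \<inter> B \<Longrightarrow> j \<in> X \<inter> B \<Longrightarrow> i = j"
        using Q unfolding separating_partitions_def by blast+
      have un: "\<Union>Q = insert a A" and dis: "\<And>Y Z. Y \<in> Q \<Longrightarrow> Z \<in> Q \<Longrightarrow> Y \<inter> Z \<noteq> {} \<Longrightarrow> Y = Z"
        and ne: "{} \<notin> Q"
        using part by (auto simp: partition_on_def disjoint_def)
      obtain Y where Y: "Y \<in> Q" "a \<in> Y" using un by blast
      have uniq: "Z = Y" if "Z \<in> Q" "a \<in> Z" for Z
        using dis[OF that(1) Y(1)] that Y by blast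
      have "{Z \<in> Q. a \<in> Z} = {Y}" using uniq Y by blast
      then have g2: "\<Union>{Z \<in> Q. a \<in> Z} - {a} = Y - {a}" by simp
      have rest: "(\<lambda>Y. Y - {a}) ` (Q - {Y}) = Q - {Y}"
      proof -
        have "(\<lambda>Y. Y - {a}) ` (Q - {Y}) = (\<lambda>Y. Y) ` (Q - {Y})"
          by (rule image_cong) (use uniq in auto)
        then show ?thesis by simp
      qed
      have "Q = insert Y (Q - {Y})" using Y by blast
      then have "(\<lambda>Y. Y - {a}) ` Q = insert (Y - {a}) (Q - {Y})"
        using rest by (metis image_insert)
      then have g1: "(\<lambda>Y. Y - {a}) ` Q - {{}} = insert (Y - {a}) (Q - {Y}) - {{}}"
        by simp
      \<comment> \<open>A block of \<open>Q\<close> contained in \<open>Y\<close> is nonempty, hence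
        meets \<open>Y\<close> and equals it. So discarding \<open>Y - {a}\<close> below loses no
        other block.\<close>
      have nin: "Y - {a} \<notin> Q - {Y}"
        using dis[of "Y - {a}" Y] Y ne by (metis Diff_iff Diff_subset inf.absorb1 singletonI)
      have "insert Y ((insert (Y - {a}) (Q - {Y}) - {{}}) - {Y - {a}}) = Q"
        using nin ne Y by auto
      moreover have "insert a (Y - {a}) = Y" using Y by auto
      ultimately have fg: "?f (?g Q) = Q"
        unfolding g1 g2 by simp
      let ?P = "insert (Y - {a}) (Q - {Y}) - {{}}"
      have "partition_on A ?P"
      proof (rule partition_onI)
        have "\<Union>?P = (Y - {a}) \<union> \<Union>(Q - {Y})" by auto
        also have "\<dots> = \<Union>Q - {a}" using Y uniq by blast
        finally show "\<Union>?P = A" using un a by auto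
      next
        fix X Z assume XZ: "X \<in> ?P" "Z \<in> ?P" "X \<noteq> Z"
        have "\<exists>X'\<in>Q. X = X' - {a}" if "X \<in> ?P" for X
        proof (cases "X = Y - {a}")
          case False
          then have "X \<in> Q" "a \<notin> X" using that uniq by blast+
          then show ?thesis by (metis Diff_insert0 Diff_empty)
        qed (use Y in blast)
        then obtain X' Z' where "X' \<in> Q" "Z' \<in> Q" "X = X' - {a}" "Z = Z' - {a}"
          using XZ by metis
        then show "disjnt X Z"
          using dis[of X' Z'] XZ unfolding disjnt_def by blast
      qed auto
      moreover have "\<forall>X\<in>?P. \<forall>i\<in>X \<inter> B. \<forall>j\<in>X \<inter> B. i = j"
        using sep Y by blast
      ultimately have "?g Q \<in> ?S"
        unfolding g1 g2 by (auto simp: separating_partitions_def)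
      with fg show ?thesis by blast
    qed
    show "\<forall>Q\<in>?T. ?f (?g Q) = Q" using * by blast
    show "?g ` ?T \<subseteq> ?S" using * by blast
  qed
  show "?f ` ?S \<subseteq> ?T"
  proof
    fix Q assume "Q \<in> ?f ` ?S"
    then obtain P X where Q: "Q = insert (insert a X) (P - {X})"
      and "P \<in> separating_partitions B A" and X: "X \<in> insert {} P"
      by auto
    then have P: "partition_on A P"
      and sep: "\<And>X i j. X \<in> P \<Longrightarrow> i \<in> X \<inter> B \<Longrightarrow> j \<in> X \<inter> B \<Longrightarrow> i = j"
      unfolding separating_partitions_def by blast+
    have un: "\<Union>P = A" and dis: "\<And>Y Z. Y \<in> P \<Longrightarrow> Z \<in> P \<Longrightarrow> Y \<noteq> Z \<Longrightarrow> Y \<inter> Z = {}"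
      and ne: "{} \<notin> P"
      using P by (auto simp: partition_on_def disjoint_def)
    have na: "a \<notin> Y" if "Y \<in> P" for Y
      using that un a by blast
    have "partition_on (insert a A) Q"
    proof (rule partition_onI)
      show "\<Union>Q = insert a A" using un X unfolding Q by auto
    next
      fix U V assume "U \<in> Q" "V \<in> Q" "U \<noteq> V"
      moreover have "disjnt (insert a X) V" if "V \<in> P - {X}" for V
        using that X na[of V] dis[of X V] by (auto simp: disjnt_def)
      moreover have "disjnt V (insert a X)" if "V \<in> P - {X}" for V
        using that X na[of V] dis[of X V] by (auto simp: disjnt_def)
      ultimately show "disjnt U V"
        using dis unfolding Q disjnt_def by blast
    next
      show "{} \<notin> Q" using ne by (auto simp: Q)
    qed
    moreover have "\<forall>X\<in>Q. \<forall>i\<in>X \<inter> B. \<forall>j\<in>X \<inter> B. i = j"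
    proof (intro ballI)
      fix U i j assume "U \<in> Q" "i \<in> U \<inter> B" "j \<in> U \<inter> B"
      \<comment> \<open>As \<open>a\<close> is outside \<open>B\<close>, two elements of
        \<open>B\<close> in the enlarged block were already together in \<open>X\<close>.\<close>
      moreover from this a have "i \<noteq> a" "j \<noteq> a" by auto
      ultimately show "i = j"
        using sep X unfolding Q by blast
    qed
    ultimately show "Q \<in> ?T"
      unfolding separating_partitions_def by blast
  qed
qed

text \<open>Letting \<open>a\<close> join an existing block keeps the number of blocks and can be
  done in \<open>card P\<close> ways; opening a new block adds one and can be done in one
  way.\<close>

lemma card_separating_partitions_insert:
  assumes "finite A" "a \<notin> A" "a \<notin> B"
  shows "card {Q \<in> separating_partitions B (insert a A). card Q = k} =
         (\<Sum>P\<in>separating_partitions B A.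
            (if card P = k then k else 0) + (if Suc (card P) = k then 1 else 0))"
proof -
  let ?f = "\<lambda>(P, X). insert (insert a X) (P - {X})"
  let ?S = "SIGMA P:separating_partitions B A. insert {} P"
  \<comment> \<open>The pairs that lead to exactly \<open>k\<close> blocks, sorted by
    \<open>P\<close>. The two conditions exclude each other, so at most one part of the union is
    nonempty.\<close>
  let ?S' = "SIGMA P:separating_partitions B A.
               (if card P = k then P else {}) \<union> (if Suc (card P) = k then {{}} else {})"
  have bij: "bij_betw ?f ?S (separating_partitions B (insert a A))"
    using bij_betw_separating_partitions_insert[OF assms(2,3)] .
  have card_f: "card (?f (P, X)) = (if X = {} then Suc (card P) else card P)"
    if "(P, X) \<in> ?S" for P X
  proof -
    have P: "partition_on A P" and X: "X = {} \<or> X \<in> P"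
      using that by (auto simp: separating_partitions_def)
    have fin: "finite P" using finite_elements[OF assms(1) P] .
    have "insert a X \<notin> P" using assms(2) partition_onD1[OF P] by blast
    then have "card (?f (P, X)) = Suc (card (P - {X}))"
      using fin by simp
    then show ?thesis
      using X card_Suc_Diff1[OF fin, of X] partition_onD3[OF P] by (cases "X = {}") simp_all
  qed
  have S': "?S' = {z \<in> ?S. card (?f z) = k}"
  proof -
    have "z \<in> ?S' \<longleftrightarrow> z \<in> ?S \<and> card (?f z) = k" for z
    proof (cases z)
      case (Pair P X)
      have "{} \<notin> P" if "P \<in> separating_partitions B A"
        using that by (auto simp: separating_partitions_def partition_on_def)
      then show ?thesis
        using card_f[of P X] by (cases "(P, X) \<in> ?S") (auto simp: Pair)
    qed
    then show ?thesis by blast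
  qed
  have "?f ` {z \<in> ?S. card (?f z) = k} = {Q \<in> ?f ` ?S. card Q = k}"
    by blast
  then have im: "?f ` ?S' = {Q \<in> separating_partitions B (insert a A). card Q = k}"
    unfolding S' bij_betw_imp_surj_on[OF bij] .
  have inj: "inj_on ?f ?S'"
    unfolding S' by (rule inj_on_subset[OF bij_betw_imp_inj_on[OF bij]]) blast
  have "card {Q \<in> separating_partitions B (insert a A). card Q = k} = card ?S'"
    using card_image[OF inj] unfolding im .
  also have "\<dots> = (\<Sum>P\<in>separating_partitions B A.
      card ((if card P = k then P else {}) \<union> (if Suc (card P) = k then {{}} else {})))"
  proof (rule card_SigmaI)
    show "finite (separating_partitions B A)"
      by (rule finite_separating_partitions[OF assms(1)])
    have "finite P" if "P \<in> separating_partitions B A" for P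
      using that finite_elements[OF assms(1)] by (simp add: separating_partitions_def)
    then show "\<forall>P\<in>separating_partitions B A.
        finite ((if card P = k then P else {}) \<union> (if Suc (card P) = k then {{}} else {}))"
      by simp
  qed
  also have "\<dots> = (\<Sum>P\<in>separating_partitions B A.
      (if card P = k then k else 0) + (if Suc (card P) = k then 1 else 0))"
    by (rule sum.cong) auto
  finally show ?thesis .
qed

section \<open>Recurrence and vanishing of the r-Stirling numbers\<close>

lemma r_Stirling2_self: "r_Stirling2 r r k = (if k = r then 1 else 0)"
proof -
  have "card ((\<lambda>i. {i}) ` {1..r}) = r"
    by (subst card_image) (auto simp: inj_on_def)
  then have "{P \<in> {(\<lambda>i. {i}) ` {1..r}}. card P = k} =
      (if k = r then {(\<lambda>i. {i}) ` {1..r}} else {})"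
    by auto
  then show ?thesis
    by (simp add: r_Stirling2_eq_card separating_partitions_self)
qed

text \<open>Since \<open>r \<le> n\<close>, the new element \<open>Suc n\<close> is not one of the
  separated ones and may go anywhere. The case \<open>k = 0\<close> is split off because
  \<open>k - 1\<close> is truncated.\<close>

lemma r_Stirling2_Suc:
  assumes "r \<le> n"
  shows "r_Stirling2 r (Suc n) k =
           k * r_Stirling2 r n k + (if k = 0 then 0 else r_Stirling2 r n (k - 1))"
proof -
  let ?U = "separating_partitions {1..r} {1..n}"
  have fin: "finite ?U" by (simp add: finite_separating_partitions)
  have "r_Stirling2 r (Suc n) k =
          card {Q \<in> separating_partitions {1..r} (insert (Suc n) {1..n}). card Q = k}"
    using assms by (simp add: r_Stirling2_eq_card atLeastAtMostSuc_conv)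
  also have "\<dots> = (\<Sum>P\<in>?U. (if card P = k then k else 0) + (if Suc (card P) = k then 1 else 0))"
    using assms by (intro card_separating_partitions_insert) auto
  also have "\<dots> = k * card {P \<in> ?U. card P = k} + card {P \<in> ?U. Suc (card P) = k}"
    using fin by (simp add: sum.distrib sum.If_cases Int_def mult.commute)
  also have "card {P \<in> ?U. Suc (card P) = k} = (if k = 0 then 0 else r_Stirling2 r n (k - 1))"
    using assms by (cases k) (auto simp: r_Stirling2_eq_card)
  finally show ?thesis
    using assms by (simp add: r_Stirling2_eq_card)
qed

lemma r_Stirling2_eq_0_less: "k < r \<Longrightarrow> r_Stirling2 r (n + r) k = 0"
  by (induction n arbitrary: k) (auto simp: r_Stirling2_self r_Stirling2_Suc)

lemma r_Stirling2_eq_0_greater: "n + r < k \<Longrightarrow> r_Stirling2 r (n + r) k = 0"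
  by (induction n arbitrary: k) (auto simp: r_Stirling2_self r_Stirling2_Suc)


section \<open>The alternating sum of r-Stirling numbers\<close>

text \<open>Both sides obey one recurrence: the value for \<open>Suc n\<close> at \<open>t\<close>
  is \<open>r + t\<close> times the value for \<open>n\<close> at \<open>t\<close> plus
  \<open>t\<close> times the value for \<open>n\<close> at \<open>t - 1\<close>. Hence
  \<open>t\<close> has to vary in the induction. For \<open>m > t\<close> both sides are
  zero.\<close>

lemma alternating_sum_r_Stirling2:
  fixes n r t m :: nat
  shows "(\<Sum>k=m..t. (-1) ^ k * (fact t / fact (k - m)) *
             of_nat (r_Stirling2 (r + k) (n + (r + k)) (r + t))) =
           ((-1) ^ t * fact m * of_nat (t choose m) * of_nat (r + m) ^ n :: rat)"
proof (induction n arbitrary: t)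
  case 0
  have "(\<Sum>k=m..t. (-1) ^ k * (fact t / fact (k - m)) *
             of_nat (r_Stirling2 (r + k) (0 + (r + k)) (r + t))) =
        (\<Sum>k=m..t. if k = t then (-1) ^ t * (fact t / fact (t - m)) else 0 :: rat)"
    by (rule sum.cong) (auto simp: r_Stirling2_self)
  also have "\<dots> = (if m \<le> t then (-1) ^ t * (fact t / fact (t - m)) else 0)"
    by simp
  also have "\<dots> = (-1) ^ t * fact m * of_nat (t choose m)"
    by (auto simp: binomial_fact)
  finally show ?case by simp
next
  case (Suc n)
  let ?c = "\<lambda>n t k. (-1) ^ k * (fact t / fact (k - m)) *
      (of_nat (r_Stirling2 (r + k) (n + (r + k)) (r + t)) :: rat)"
  show ?case
  proof (cases t)
    case 0
    \<comment> \<open>Only \<open>k = 0\<close> can occur, and the second term of the recurrence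
      vanishes: for \<open>r > 0\<close> there are too few blocks, and for \<open>r = 0\<close> the
      recurrence has no such term.\<close>
    have "r_Stirling2 r (Suc (n + r)) r = r * r_Stirling2 r (n + r) r"
      using r_Stirling2_eq_0_less[of "r - 1" r n] by (simp add: r_Stirling2_Suc)
    then show ?thesis
      using Suc.IH[of 0] by (cases "m = 0") (auto simp: 0)
  next
    case t: (Suc s)
    have "?c (Suc n) t k = of_nat (r + t) * ?c n t k + of_nat t * ?c n s k" for k
      by (simp add: r_Stirling2_Suc t field_simps)
    then have "(\<Sum>k=m..t. ?c (Suc n) t k) =
        of_nat (r + t) * (\<Sum>k=m..t. ?c n t k) + of_nat t * (\<Sum>k=m..t. ?c n s k)"
      by (simp only: sum.distrib sum_distrib_left)
    \<comment> \<open>The term \<open>k = t\<close> vanishes, as \<open>r + s\<close> blocks cannot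
      separate \<open>r + t\<close> elements.\<close>
    also have "(\<Sum>k=m..t. ?c n s k) = (\<Sum>k=m..s. ?c n s k)"
      using r_Stirling2_eq_0_less[of "r + s" "r + t" n] by (auto simp: t)
    also have "of_nat (r + t) * (\<Sum>k=m..t. ?c n t k) + of_nat t * (\<Sum>k=m..s. ?c n s k) =
      (-1) ^ t * fact m * of_nat (r + m) ^ n *
        (of_nat (r + t) * of_nat (t choose m) - of_nat (t * (s choose m)))"
      unfolding Suc.IH by (simp add: t algebra_simps)
    \<comment> \<open>This rests on the absorption
      \<open>t * (t - 1 choose m) = (t - m) * (t choose m)\<close>; the subtraction is faithful only
      for \<open>m \<le> t\<close>.\<close>
    also have "of_nat (r + t) * of_nat (t choose m) - of_nat (t * (s choose m)) =
               (of_nat (r + m) * of_nat (t choose m) :: rat)"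
    proof (cases "m \<le> t")
      case True
      have "t * (s choose m) = (t - m) * (t choose m)"
        using binomial_absorb_comp[of t m] by (simp add: t)
      then have "of_nat (t * (s choose m)) = (of_nat t - of_nat m) * (of_nat (t choose m) :: rat)"
        using True by (metis of_nat_diff of_nat_mult)
      then show ?thesis by (simp add: algebra_simps)
    next
      case False
      then have "t choose m = 0" "s choose m = 0"
        by (simp_all add: t binomial_eq_0)
      then show ?thesis by (simp add: binomial_eq_0)
    qed
    finally show ?thesis by simp
  qed
qed

section \<open>Coefficients of the polynomials\<close>

text \<open>The cut-off at \<open>n\<close> disappears because the Stirling number is zero for
  \<open>j > n\<close>.\<close>

lemma coeff_Fubini_poly:
  "coeff (Fubini_poly n r s) j = of_nat (r_Stirling2 r (n + r) (j + r)) * fact (j + s)"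
proof -
  have "coeff (Fubini_poly n r s) j =
      (\<Sum>k=0..n. if k = j then of_nat (r_Stirling2 r (n + r) (k + r)) * fact (k + s) else 0)"
    by (simp add: Fubini_poly_def coeff_sum)
  also have "\<dots> = (if j \<le> n then of_nat (r_Stirling2 r (n + r) (j + r)) * fact (j + s) else 0)"
    by simp
  finally show ?thesis
    using r_Stirling2_eq_0_greater[of n r "j + r"] by auto
qed

lemma coeff_P_poly:
  "coeff (P_poly n r) t =
     (if t \<le> n then (-1) ^ (n - t) * of_nat ((n - t + r) choose r) else 0)"
proof -
  \<comment> \<open>The conjunct \<open>t \<le> n\<close> matters: for larger \<open>t\<close> the
    truncated \<open>n - t\<close> would wrongly select \<open>j = 0\<close>.\<close>
  have "coeff (P_poly n r) t =
      (\<Sum>j=0..n. if j = n - t \<and> t \<le> n then (-1) ^ j * of_nat ((j + r) choose r) else 0)"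
    unfolding P_poly_def coeff_sum by (rule sum.cong) auto
  then show ?thesis by (cases "t \<le> n") simp_all
qed

lemma neg_monom_power: "(- [:0, 1:]) ^ k = monom ((-1) ^ k :: 'a::comm_ring_1) k"
proof -
  have "- [:0, 1:] = monom (-1 :: 'a) 1"
    by (simp add: monom_altdef)
  then show ?thesis by (simp only: monom_power mult_1)
qed

text \<open>The power of \<open>x\<close> shifts the index to \<open>t - k\<close>. There the
  factorial becomes \<open>fact t\<close> and the number of blocks \<open>r + t\<close>, both
  independent of \<open>k\<close>; this is the effect of the parameters \<open>r + k\<close> and
  \<open>k\<close>.\<close>

lemma coeff_Fubini_sum:
  "coeff (\<Sum>k=m..N. (- [:0, 1:]) ^ k * smult (1 / fact (k - m)) (Fubini_poly n (r + k) k)) t =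
   (\<Sum>k=m..min N t. (-1) ^ k * (fact t / fact (k - m)) *
      of_nat (r_Stirling2 (r + k) (n + (r + k)) (r + t)))"
proof -
  have "coeff (\<Sum>k=m..N. (- [:0, 1:]) ^ k * smult (1 / fact (k - m)) (Fubini_poly n (r + k) k)) t =
    (\<Sum>k=m..N. if k \<le> t then (-1) ^ k * (fact t / fact (k - m)) *
      of_nat (r_Stirling2 (r + k) (n + (r + k)) (r + t)) else 0)"
    unfolding coeff_sum neg_monom_power
    by (rule sum.cong[OF refl], simp only: coeff_monom_mult coeff_smult coeff_Fubini_poly)
       (auto simp: ac_simps)
  also have "\<dots> = (\<Sum>k\<in>{k\<in>{m..N}. k \<le> t}. (-1) ^ k * (fact t / fact (k - m)) *
      of_nat (r_Stirling2 (r + k) (n + (r + k)) (r + t)))"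
    by (rule sum.inter_filter[symmetric]) simp
  also have "{k\<in>{m..N}. k \<le> t} = {m..min N t}" by auto
  finally show ?thesis .
qed

section \<open>Congruences for factorials, binomial coefficients and signs\<close>

lemma prime_dvd_fact_div_fact:
  assumes "prime p" "j < p" "p \<le> t"
  shows "p dvd (fact t div fact j :: nat)"
proof -
  have "p dvd (fact t :: nat)"
    using assms prime_dvd_fact_iff by blast
  moreover have "fact t = fact j * (fact t div fact j :: nat)"
    using assms by (simp add: fact_dvd)
  moreover have "\<not> p dvd (fact j :: nat)"
    using assms prime_dvd_fact_iff[of p j] by auto
  ultimately show ?thesis
    using assms(1) by (metis prime_dvd_mult_iff)
qed

text \<open>The factor \<open>fact m\<close> turns both binomials into products, so that passing to
  \<open>Suc m\<close> adds just one factor on each side: \<open>p - t + m\<close> on the left and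
  \<open>-(t - m)\<close> on the right.\<close>

lemma fact_mult_binomial_cong:
  assumes "t < p"
  shows "[int (fact m * ((p - 1 - t + m) choose m)) =
            (-1) ^ m * int (fact m * (t choose m))] (mod int p)"
proof (induction m)
  case 0
  then show ?case by simp
next
  case (Suc m)
  have A: "fact (Suc m) * ((a + Suc m) choose Suc m) =
      (a + Suc m) * (fact m * ((a + m) choose m))" for a
    using Suc_times_binomial_eq[of "a + m" m]
    by (simp add: algebra_simps del: binomial_Suc_Suc)
  \<comment> \<open>The difference is taken in the integers. Where it is negative, both binomials
    vanish.\<close>
  have B: "int (fact (Suc m) * (t choose Suc m)) = (int t - int m) * int (fact m * (t choose m))"
  proof (cases "m \<le> t")
    case True
    have "fact (Suc m) * (t choose Suc m) = fact m * (Suc m * (t choose Suc m))"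
      by (simp only: fact_Suc of_nat_id ac_simps)
    also have "\<dots> = (t - m) * (fact m * (t choose m))"
      by (simp only: binomial_absorption binomial_absorb_comp[symmetric] ac_simps)
    finally have "fact (Suc m) * (t choose Suc m) = (t - m) * (fact m * (t choose m))" .
    then show ?thesis using True by (simp only: of_nat_mult of_nat_diff)
  qed (simp add: binomial_eq_0)
  have "[int (p - 1 - t + Suc m) = - (int t - int m)] (mod int p)"
    using assms by (simp add: cong_iff_dvd_diff of_nat_diff)
  note cong_mult[OF this Suc.IH]
  also have "- (int t - int m) * ((-1) ^ m * int (fact m * (t choose m))) =
      (-1) ^ Suc m * ((int t - int m) * int (fact m * (t choose m)))"
    by (simp add: algebra_simps)
  finally show ?case
    unfolding A B of_nat_mult[of "p - 1 - t + Suc m"] .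
qed

text \<open>For odd \<open>p\<close> the exponents have the same parity; for \<open>p = 2\<close>
  the signs do not matter.\<close>

lemma cong_neg_one_power_prime_diff:
  assumes "prime p" "t < p"
  shows "[(-1) ^ (p - 1 - t) = (-1) ^ t] (mod int p)"
proof (cases "p = 2")
  case True
  then show ?thesis using assms(2) by (auto simp: less_2_cases_iff cong_iff_dvd_diff)
next
  case False
  then have "odd p" using assms(1) primes_dvd_imp_eq two_is_prime_nat by blast
  then have "even (p - 1 - t) \<longleftrightarrow> even t" using assms(2) by auto
  then show ?thesis by (simp add: minus_one_power_iff)
qed

section \<open>Comparison of coefficients modulo \<open>p\<close>\<close>

theorem theorem17:
  fixes n r p :: nat
  assumes "prime p"
  shows "(\<forall>m\<in>{0..p - 1}.
            padic_poly_cong p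
              (\<Sum>k=m..p - 1. (- [:0, 1:]) ^ k * smult (1 / fact (k - m)) (Fubini_poly n (r + k) k))
              (smult ((-1) ^ m * fact m * of_nat (r + m) ^ n) (P_poly (p - 1) m)))
       \<and> padic_poly_cong p
            (\<Sum>k=0..p - 1. (- [:0, 1:]) ^ k * smult (1 / fact k) (Fubini_poly n (r + k) k))
            (smult (of_nat r ^ n) (\<Sum>i=0..p - 1. (- [:0, 1:]) ^ i))"
proof (intro conjI ballI)
  have p: "p > 0" "p \<ge> 2" using assms prime_gt_0_nat prime_ge_2_nat by auto
  let ?L = "\<lambda>m. \<Sum>k=m..p - 1. (- [:0, 1:]) ^ k * smult (1 / fact (k - m)) (Fubini_poly n (r + k) k)"
  \<comment> \<open>Integer values of the left coefficients, as needed to reduce the p-adic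
    congruence to integers. For \<open>t < p\<close> the sum runs up to \<open>t\<close> and has the
    closed form; from \<open>p\<close> on it is cut at \<open>p - 1\<close> and stays a sum.\<close>
  define a :: "nat \<Rightarrow> nat \<Rightarrow> int" where "a m t =
    (if t < p then (-1) ^ t * fact m * int (t choose m) * int (r + m) ^ n
     else \<Sum>k=m..p - 1. (-1) ^ k * int (fact t div fact (k - m)) *
            int (r_Stirling2 (r + k) (n + (r + k)) (r + t)))" for m t
  have a: "coeff (?L m) t = of_int (a m t)" for m t
  proof (cases "t < p")
    case True
    then have "min (p - 1) t = t" by auto
    then show ?thesis
      using True by (simp only: coeff_Fubini_sum alternating_sum_r_Stirling2) (simp add: a_def)
  next
    case False
    then have "min (p - 1) t = p - 1" by auto
    \<comment> \<open>Here \<open>k - m < p \<le> t\<close>, so the natural division is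
      exact.\<close>
    moreover have "(fact t / fact (k - m) :: rat) = of_nat (fact t div fact (k - m))"
      if "k \<in> {m..p - 1}" for k
    proof -
      have "(fact (k - m) dvd (fact t :: nat))"
        using that False by (intro fact_dvd) auto
      then show ?thesis
        by (simp add: field_char_0_class.of_nat_div)
    qed
    ultimately show ?thesis
      using False by (simp only: coeff_Fubini_sum) (simp add: a_def)
  qed
  have a0: "[a m t = 0] (mod int p)" if "\<not> t < p" for m t
  proof -
    have "int p dvd int (fact t div fact (k - m))" if "k \<in> {m..p - 1}" for k
      using that \<open>\<not> t < p\<close> p prime_dvd_fact_div_fact[OF assms, of "k - m" t]
      by (simp only: int_dvd_int_iff) auto
    then show ?thesis
      using that by (auto simp: a_def cong_0_iff intro!: dvd_sum)
  qed
  show "padic_poly_cong p (?L m)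
      (smult ((-1) ^ m * fact m * of_nat (r + m) ^ n) (P_poly (p - 1) m))"
    for m
  proof -
    define b :: "nat \<Rightarrow> int" where "b t =
      (if t < p then (-1) ^ m * int (r + m) ^ n * ((-1) ^ (p - 1 - t) *
         int (fact m * ((p - 1 - t + m) choose m))) else 0)" for t
    have b: "coeff (smult ((-1) ^ m * fact m * of_nat (r + m) ^ n) (P_poly (p - 1) m)) t =
        of_int (b t)" for t
      using p by (auto simp: coeff_P_poly b_def)
    have "[a m t = b t] (mod int p)" for t
    proof (cases "t < p")
      case True
      have "[b t =
          (-1) ^ m * int (r + m) ^ n * ((-1) ^ t * ((-1) ^ m * int (fact m * (t choose m))))] (mod int p)"
        using cong_scalar_left[OF cong_mult[OF cong_neg_one_power_prime_diff[OF assms True]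
              fact_mult_binomial_cong[OF True]]] True
        unfolding b_def by (simp only: if_True)
      \<comment> \<open>One sign \<open>(-1) ^ m\<close> comes from the right-hand side of the
        theorem, the other from the binomial congruence; they cancel.\<close>
      also have "(-1) ^ m * int (r + m) ^ n * ((-1) ^ t * ((-1) ^ m * int (fact m * (t choose m)))) =
         ((-1) ^ m * (-1) ^ m) * a m t"
        using True by (simp add: a_def)
      also have "\<dots> = a m t" by (simp flip: power_add)
      finally show ?thesis by (rule cong_sym)
    qed (use a0 in \<open>simp add: b_def\<close>)
    then show ?thesis
      using padic_poly_cong_of_int_iff[OF p(1) a b] by blast
  qed
  have b: "coeff (smult (of_nat r ^ n) (\<Sum>i=0..p - 1. (- [:0, 1:]) ^ i)) t =
      (of_int (if t < p then int r ^ n * (-1) ^ t else 0) :: rat)" for t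
    unfolding neg_monom_power using p by (auto simp: coeff_sum)
  \<comment> \<open>For \<open>m = 0\<close> the coefficients below \<open>p\<close> agree exactly;
    only those from \<open>p\<close> on need reduction modulo \<open>p\<close>.\<close>
  have "[a 0 t = (if t < p then int r ^ n * (-1) ^ t else 0)] (mod int p)" for t
    using a0[of t 0] by (simp add: a_def mult.commute)
  then have "padic_poly_cong p (?L 0)
      (smult (of_nat r ^ n) (\<Sum>i=0..p - 1. (- [:0, 1:]) ^ i))"
    using padic_poly_cong_of_int_iff[OF p(1) a b] by blast
  then show "padic_poly_cong p
            (\<Sum>k=0..p - 1. (- [:0, 1:]) ^ k * smult (1 / fact k) (Fubini_poly n (r + k) k))
            (smult (of_nat r ^ n) (\<Sum>i=0..p - 1. (- [:0, 1:]) ^ i))"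
    by simp
qed

end
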